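(* Let $X$ be a separable metric space. Then $X$ has sharp measure zero if and only if for every sequence $(\varepsilon_n)_{n\in\mathbb N}$ of positive reals there is a sequence $(U_n)_{n\in\mathbb N}$ of subsets of $X$ with $\operatorname{diam}U_n\le\varepsilon_n$ for all $n$ which is a $\gamma$-groupable cover of $X$.
   Context: A sequence $(V_j)$ of sets is a $\gamma$-cover of $X$ if every $x\in X$ belongs to all but finitely many $V_j$. A sequence $(U_n)$ is a $\gamma$-groupable cover of $X$ if there is a partition of $\mathbb N$ into consecutive finite intervals $I_0<I_1<I_2<\dots$ such that $(\bigcup_{n\in I_j}U_n)_{j\in\mathbb N}$ is a $\gamma$-cover of $X$. A gauge is a non-decreasing right-continuous $h:[0,\infty)\to[0,\infty)$ with $h(0)=0$ and $h(r)>0$ for $r>0$. $\mathcal H^h(E)=\sup_{\delta>0}\inf\{\sum_n h(\operatorname{diam}E_n)\}$, infimum over countable covers of $E$ by sets of diameter $\le\delta$; $\dim_H E=\inf\{s>0:\mathcal H^s(E)=0\}$ with $\mathcal H^s$ for $h(r)=r^s$. A metric space $X$ has sharp measure zero if for every uniformly continuous map $f:X\to Y$ into a complete metric space $Y$ there is a $\sigma$-compact $K\subseteq Y$ with $f(X)\subseteq K$ and $\dim_H K=0$. *)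

theory Defs
  imports "HOL-Analysis.Analysis"
begin

text \<open>
  Metric spaces are elements of the library type \<open>'a metric\<close> (a carrier \<open>mspace m\<close> with a
  distance function \<open>mdist m\<close>), so that one may quantify over all metric spaces carried
  by subsets of a given type.
\<close>

text \<open>Extended-valued diameter; the diameter of the empty set is 0.\<close>

definition mdiam :: "'a metric \<Rightarrow> 'a set \<Rightarrow> ennreal" where
  "mdiam m E = (SUP x\<in>E. SUP y\<in>E. ennreal (mdist m x y))"

definition hausdorff_gauge :: "(real \<Rightarrow> real) \<Rightarrow> bool" where
  "hausdorff_gauge h \<longleftrightarrow>
     mono_on {0..} h \<and> (\<forall>r\<ge>0. continuous (at_right r) h) \<and> h 0 = 0 \<and> (\<forall>r>0. h r > 0)"

text \<open>
  The empty set may occur in a cover and contributes \<open>h 0 = 0\<close>, so covers indexed by the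
  natural numbers account for all countable covers. Only covers by sets of finite diameter
  occur, hence \<open>enn2real\<close> is harmless.
\<close>

definition hausdorff_measure :: "'a metric \<Rightarrow> (real \<Rightarrow> real) \<Rightarrow> 'a set \<Rightarrow> ennreal" where
  "hausdorff_measure m h E =
     (SUP \<delta>\<in>{0<..}. INF C\<in>{C :: nat \<Rightarrow> 'a set. (\<forall>n. C n \<subseteq> mspace m \<and> mdiam m (C n) \<le> ennreal \<delta>) \<and>
                                     E \<subseteq> (\<Union>n. C n)}.
        \<Sum>n. ennreal (h (enn2real (mdiam m (C n)))))"

definition hausdorff_dim :: "'a metric \<Rightarrow> 'a set \<Rightarrow> ennreal" where
  "hausdorff_dim m E =
     Inf {ennreal s | s. s > 0 \<and> hausdorff_measure m (\<lambda>r. r powr s) E = 0}"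

lemma hausdorff_gauge_powr:
  assumes "s > 0"
  shows "hausdorff_gauge (\<lambda>r. r powr s)"
proof -
  have "continuous (at_right r) (\<lambda>r. r powr s)" if "r \<ge> 0" for r :: real
  proof -
    have "continuous_on {0..} (\<lambda>r::real. r powr s)"
      using assms by (intro continuous_on_powr') (auto intro: continuous_intros)
    then have "continuous (at r within {0..}) (\<lambda>r. r powr s)"
      using that by (simp add: continuous_on_eq_continuous_within)
    then show ?thesis
      using that by (auto intro: continuous_within_subset)
  qed
  moreover have "mono_on {0..} (\<lambda>r::real. r powr s)"
    using assms by (auto intro!: mono_onI powr_mono2)
  ultimately show ?thesis
    by (simp add: hausdorff_gauge_def)
qed

definition sigma_compactin :: "'a topology \<Rightarrow> 'a set \<Rightarrow> bool" where
  "sigma_compactin T K \<longleftrightarrow> (\<exists>C :: nat \<Rightarrow> 'a set. (\<forall>n. compactin T (C n)) \<and> K = (\<Union>n. C n))"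

text \<open>
  A formula cannot quantify over types, so the type carrying the target spaces is a parameter.
  For separable \<open>X\<close> the choice does not matter as long as that type has at least continuum many
  elements: the closure of \<open>f ` X\<close> is a complete separable metric space, hence has at most
  continuum many points, and \<open>K\<close> may be intersected with it.
\<close>

definition sharp_measure_zero :: "'b itself \<Rightarrow> 'a metric \<Rightarrow> bool" where
  "sharp_measure_zero (_ :: 'b itself) X \<longleftrightarrow>
     (\<forall>(Y :: 'b metric) f. mcomplete_of Y \<and> uniformly_continuous_map X Y f \<longrightarrow>
        (\<exists>K. K \<subseteq> mspace Y \<and> sigma_compactin (mtopology_of Y) K \<and>
             f ` mspace X \<subseteq> K \<and> hausdorff_dim Y K = 0))"

definition gamma_cover :: "'a set \<Rightarrow> (nat \<Rightarrow> 'a set) \<Rightarrow> bool" where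
  "gamma_cover S V \<longleftrightarrow> (\<forall>x\<in>S. finite {j. x \<notin> V j})"

text \<open>The consecutive finite intervals are \<open>I\<^sub>j = {k j..<k (Suc j)}\<close>.\<close>

definition gamma_groupable_cover :: "'a set \<Rightarrow> (nat \<Rightarrow> 'a set) \<Rightarrow> bool" where
  "gamma_groupable_cover S U \<longleftrightarrow>
     (\<exists>k :: nat \<Rightarrow> nat. k 0 = 0 \<and> strict_mono k \<and>
        gamma_cover S (\<lambda>j. \<Union>n\<in>{k j..<k (Suc j)}. U n))"

end

theory Submission
  imports Defs
begin

text \<open>
  Suppose that groupable covers exist and let \<open>f\<close> be uniformly continuous. Choose a groupable cover
  \<open>U\<close> such that \<open>f ` U n\<close> has diameter at most \<open>2\<^sup>-\<^sup>n\<close>, and let \<open>V j\<close> be the union of the closures of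
  the images over the \<open>j\<close>-th group. The sets \<open>\<Inter>j\<ge>m. V j\<close> are closed and totally bounded, and their
  union over \<open>m\<close> contains the image and is covered by every tail of the sequence of closures, so it has
  dimension 0.

  Conversely, given \<open>\<epsilon>\<close> and a dense sequence \<open>q\<close>, the map \<open>x \<mapsto> (min (1 / (k + 1)) (d x (q n) / \<epsilon> k))\<close>
  into the bounded sequences indexed by pairs \<open>(k, n)\<close> is uniformly continuous, and images at distance less than
  \<open>1 / (n + 1)\<close> come from points at distance at most \<open>\<epsilon> n\<close>. If the image lies in a \<open>\<sigma>\<close>-compact set
  of dimension 0, then each compact piece has finite covers with arbitrarily small sum of diameters.
  Listing such a cover by decreasing diameter makes the \<open>i\<close>-th diameter at most the sum divided by
  \<open>i + 1\<close>, which is small enough to place the cover as the next group after any finite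
  number of sets.
\<close>

section \<open>Diameters, closures and total boundedness\<close>

lemma mdiam_le_iff:
  assumes "r \<ge> 0"
  shows "mdiam m E \<le> ennreal r \<longleftrightarrow> (\<forall>x\<in>E. \<forall>y\<in>E. mdist m x y \<le> r)"
  using assms by (simp add: mdiam_def SUP_le_iff)

text \<open>Points of the closure lie within \<open>e / 2\<close> of points of \<open>E\<close>, so
  their distance exceeds \<open>r\<close> by at most \<open>e\<close>. Covering sets can therefore
  be closed up without loss in the diameter bounds.\<close>

lemma mdist_le_closure_of:
  assumes E: "\<And>x y. x \<in> E \<Longrightarrow> y \<in> E \<Longrightarrow> mdist m x y \<le> r"
    and "E \<subseteq> mspace m"
    and xy: "x \<in> mtopology_of m closure_of E" "y \<in> mtopology_of m closure_of E"
  shows "mdist m x y \<le> r"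
proof (rule field_le_epsilon)
  interpret Metric_space "mspace m" "mdist m" by simp
  fix e :: real assume "e > 0"
  have cl: "z \<in> mspace m \<and> (\<exists>w\<in>E. mdist m z w < e / 2)" if "z \<in> mtopology_of m closure_of E" for z
  proof -
    have "e / 2 > 0" using \<open>e > 0\<close> by simp
    with that show ?thesis unfolding mtopology_of_def metric_closure_of by fastforce
  qed
  obtain a where a: "a \<in> E" "mdist m x a < e / 2" using cl[OF xy(1)] by blast
  obtain b where b: "b \<in> E" "mdist m y b < e / 2" using cl[OF xy(2)] by blast
  have M: "x \<in> mspace m" "y \<in> mspace m" "a \<in> mspace m" "b \<in> mspace m"
    using cl xy a b assms(2) by auto
  have "mdist m x y \<le> mdist m x a + mdist m a y" "mdist m a y \<le> mdist m a b + mdist m b y"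
    using M by (auto intro: mdist_triangle)
  moreover have "mdist m b y = mdist m y b" using M by (simp add: mdist_commute)
  ultimately show "mdist m x y \<le> r + e" using a b E[of a b] by linarith
qed

text \<open>The centres of the balls have to lie in \<open>S\<close> itself, so a point of
  \<open>V \<inter> S\<close> is chosen for each \<open>V\<close> that meets \<open>S\<close>; the
  ball of radius \<open>e\<close> around it contains \<open>V \<inter> S\<close>.\<close>

lemma mtotally_bounded_if_finite_small_covers:
  assumes S: "S \<subseteq> mspace m"
    and cov: "\<And>e. e > 0 \<Longrightarrow> \<exists>\<V>. finite \<V> \<and> S \<subseteq> \<Union>\<V> \<and> (\<forall>V\<in>\<V>. \<forall>x\<in>V. \<forall>y\<in>V. mdist m x y < e)"
  shows "Metric_space.mtotally_bounded (mspace m) (mdist m) S"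
proof -
  interpret Metric_space "mspace m" "mdist m" by simp
  show ?thesis
    unfolding mtotally_bounded_def
  proof (intro allI impI)
    fix e :: real assume "e > 0"
    from cov[OF this] obtain \<V>
      where V: "finite \<V>" "S \<subseteq> \<Union>\<V>" "\<forall>V\<in>\<V>. \<forall>x\<in>V. \<forall>y\<in>V. mdist m x y < e"
      by (elim exE conjE)
    define p where "p = (\<lambda>V. SOME x. x \<in> V \<inter> S)"
    have p: "p V \<in> V \<inter> S" if "V \<inter> S \<noteq> {}" for V
      unfolding p_def using that by (meson ex_in_conv someI)
    define K where "K = p ` {V\<in>\<V>. V \<inter> S \<noteq> {}}"
    have "S \<subseteq> (\<Union>x\<in>K. mball x e)"
    proof
      fix x assume "x \<in> S"
      then obtain V where "V \<in> \<V>" "x \<in> V" using V by auto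
      then have "p V \<in> V \<inter> S" "p V \<in> K" using p \<open>x \<in> S\<close> by (auto simp: K_def)
      then have "x \<in> mball (p V) e" using V(3) \<open>V \<in> \<V>\<close> \<open>x \<in> V\<close> \<open>x \<in> S\<close> S by (simp add: subset_iff)
      then show "x \<in> (\<Union>x\<in>K. mball x e)" using \<open>p V \<in> K\<close> by blast
    qed
    moreover have "finite K" "K \<subseteq> S" using V(1) p by (auto simp: K_def)
    ultimately show "\<exists>K. finite K \<and> K \<subseteq> S \<and> S \<subseteq> (\<Union>x\<in>K. mball x e)" by blast
  qed
qed

section \<open>Criteria for Hausdorff measure and dimension zero\<close>

lemma hausdorff_measure_eq_0I:
  assumes "\<And>\<delta> e. \<delta> > 0 \<Longrightarrow> e > 0 \<Longrightarrow> \<exists>C :: nat \<Rightarrow> 'a set.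
      (\<forall>n. C n \<subseteq> mspace m \<and> mdiam m (C n) \<le> ennreal \<delta>) \<and> E \<subseteq> (\<Union>n. C n) \<and>
      (\<Sum>n. ennreal (h (enn2real (mdiam m (C n))))) \<le> ennreal e"
  shows "hausdorff_measure m h E = 0"
proof -
  have "(INF C\<in>{C :: nat \<Rightarrow> 'a set. (\<forall>n. C n \<subseteq> mspace m \<and> mdiam m (C n) \<le> ennreal \<delta>) \<and>
          E \<subseteq> (\<Union>n. C n)}. \<Sum>n. ennreal (h (enn2real (mdiam m (C n))))) \<le> 0" (is "?I \<le> 0")
    if "\<delta> > 0" for \<delta>
  proof (rule ennreal_le_epsilon)
    fix e :: real assume "e > 0"
    obtain C where "\<forall>n. C n \<subseteq> mspace m \<and> mdiam m (C n) \<le> ennreal \<delta>" "E \<subseteq> (\<Union>n. C n)"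
      "(\<Sum>n. ennreal (h (enn2real (mdiam m (C n))))) \<le> ennreal e"
      using assms[OF \<open>\<delta> > 0\<close> \<open>e > 0\<close>] by blast
    then show "?I \<le> 0 + ennreal e"
      by (auto intro!: INF_lower2[of C])
  qed
  then have "hausdorff_measure m h E \<le> 0"
    unfolding hausdorff_measure_def by (intro SUP_least) auto
  then show ?thesis by simp
qed

lemma hausdorff_dim_eq_0I:
  assumes "\<And>s. s > 0 \<Longrightarrow> hausdorff_measure m (\<lambda>r. r powr s) E = 0"
  shows "hausdorff_dim m E = 0"
proof -
  have "hausdorff_dim m E \<le> 0"
  proof (rule ennreal_le_epsilon)
    fix e :: real assume "e > 0"
    then show "hausdorff_dim m E \<le> 0 + ennreal e"
      unfolding hausdorff_dim_def using assms by (auto intro!: Inf_lower)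
  qed
  then show ?thesis by simp
qed

section \<open>From groupable covers to sharp measure zero\<close>

lemma sharp_measure_zero_if_gamma_groupable_covers:
  fixes X :: "'a metric"
  assumes cov: "\<And>\<epsilon> :: nat \<Rightarrow> real. (\<And>n. \<epsilon> n > 0) \<Longrightarrow>
      \<exists>U :: nat \<Rightarrow> 'a set. (\<forall>n. U n \<subseteq> mspace X \<and> mdiam X (U n) \<le> ennreal (\<epsilon> n)) \<and>
        gamma_groupable_cover (mspace X) U"
  shows "sharp_measure_zero TYPE('b) X"
  unfolding sharp_measure_zero_def
proof (intro allI impI, elim conjE)
  fix Y :: "'b metric" and f
  assume "mcomplete_of Y" and f: "uniformly_continuous_map X Y f"
  interpret Y: Metric_space "mspace Y" "mdist Y" by simp
  have comp: "Y.mcomplete" using \<open>mcomplete_of Y\<close> by (simp add: mcomplete_of_def)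
  have fY: "f x \<in> mspace Y" if "x \<in> mspace X" for x
    using f that by (auto simp: uniformly_continuous_map_def)
  have "\<forall>n::nat. \<exists>\<delta>>0. \<forall>x\<in>mspace X. \<forall>y\<in>mspace X. mdist X x y < \<delta> \<longrightarrow> mdist Y (f x) (f y) < (1/2)^n"
  proof
    fix n :: nat
    have "(1/2::real)^n > 0" by simp
    then show "\<exists>\<delta>>0. \<forall>x\<in>mspace X. \<forall>y\<in>mspace X. mdist X x y < \<delta> \<longrightarrow> mdist Y (f x) (f y) < (1/2)^n"
      using f unfolding uniformly_continuous_map_def by meson
  qed
  from choice[OF this] obtain \<delta> where \<delta>_all: "\<forall>n. \<delta> n > 0 \<and>
      (\<forall>x\<in>mspace X. \<forall>y\<in>mspace X. mdist X x y < \<delta> n \<longrightarrow> mdist Y (f x) (f y) < (1/2)^n)" ..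
  have \<delta>: "\<And>n. \<delta> n > 0"
    and \<delta>f: "\<And>n x y. x \<in> mspace X \<Longrightarrow> y \<in> mspace X \<Longrightarrow> mdist X x y < \<delta> n \<Longrightarrow> mdist Y (f x) (f y) < (1/2)^n"
    using \<delta>_all by simp_all
  \<comment> \<open>Halving \<open>\<delta> n\<close> turns the non-strict diameter bound into the
    strict inequality that uniform continuity asks for.\<close>
  have "\<exists>U. (\<forall>n. U n \<subseteq> mspace X \<and> mdiam X (U n) \<le> ennreal (\<delta> n / 2)) \<and> gamma_groupable_cover (mspace X) U"
    using \<delta> by (intro cov) simp
  then obtain U where Uall: "\<forall>n. U n \<subseteq> mspace X \<and> mdiam X (U n) \<le> ennreal (\<delta> n / 2)"
    and grp: "gamma_groupable_cover (mspace X) U"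
    by (elim exE conjE)
  have U: "\<And>n. U n \<subseteq> mspace X" "\<And>n. mdiam X (U n) \<le> ennreal (\<delta> n / 2)"
    using Uall by simp_all
  obtain k where k: "k 0 = 0" "strict_mono k"
    and gam: "gamma_cover (mspace X) (\<lambda>j. \<Union>n\<in>{k j..<k (Suc j)}. U n)"
    using grp unfolding gamma_groupable_cover_def by blast
  define W where "W n = mtopology_of Y closure_of (f ` U n)" for n
  have WY: "W n \<subseteq> mspace Y" for n
    unfolding W_def using closure_of_subset_topspace by force
  have Wd: "mdist Y x y \<le> (1/2)^n" if "x \<in> W n" "y \<in> W n" for n x y
  proof (rule mdist_le_closure_of[OF _ _ that[unfolded W_def]])
    show "f ` U n \<subseteq> mspace Y" using U fY by auto
  next
    fix a b assume "a \<in> f ` U n" "b \<in> f ` U n"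
    then obtain x y where xy: "x \<in> U n" "y \<in> U n" "a = f x" "b = f y" by auto
    have "mdist X x y \<le> \<delta> n / 2"
      using U(2)[of n] xy \<delta>[of n] by (subst (asm) mdiam_le_iff) auto
    then have "mdist X x y < \<delta> n" using \<delta>[of n] by linarith
    then show "mdist Y a b \<le> (1/2)^n"
      using \<delta>f[of x y n] xy U(1)[of n] by force
  qed
  define V where "V j = (\<Union>n\<in>{k j..<k (Suc j)}. W n)" for j
  \<comment> \<open>\<open>K m\<close> collects the points that lie in every group from the
    \<open>m\<close>-th on, so the gamma-cover property puts each image point into some
    \<open>K m\<close>.\<close>
  define K where "K m = (\<Inter>j\<in>{m..}. V j)" for m
  have kge: "n \<le> k n" for n using k(2) by (rule strict_mono_imp_increasing)
  have closedV: "closedin (mtopology_of Y) (V j)" for j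
    unfolding V_def W_def by (intro closedin_Union) auto
  have KY: "K m \<subseteq> mspace Y" for m
    using WY unfolding K_def V_def by fastforce
  have closedK: "closedin (mtopology_of Y) (K m)" for m
    unfolding K_def using closedV by (intro closedin_Inter) auto
  have tbK: "Y.mtotally_bounded (K m)" for m
  proof (rule mtotally_bounded_if_finite_small_covers[OF KY])
    fix e :: real assume "e > 0"
    then obtain N where N: "(1/2)^N < e"
      using real_arch_pow_inv[of e "1/2"] by auto
    \<comment> \<open>A single late group suffices: \<open>j \<ge> m\<close> makes
      \<open>V j\<close> cover \<open>K m\<close>, and \<open>j \<ge> N\<close> with
      \<open>k j \<ge> j\<close> makes each of its finitely many sets smaller than
      \<open>e\<close>.\<close>
    define j where "j = max m N"
    have "K m \<subseteq> \<Union>(W ` {k j..<k (Suc j)})"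
      unfolding K_def V_def j_def by auto
    moreover have "mdist Y x y < e" if "n \<ge> k j" "x \<in> W n" "y \<in> W n" for n x y
    proof -
      have "N \<le> n" using kge[of j] that by (simp add: j_def)
      then have "(1/2::real)^n \<le> (1/2)^N" by (intro power_decreasing) auto
      then show ?thesis using Wd[OF that(2,3)] N by linarith
    qed
    ultimately show "\<exists>\<V>. finite \<V> \<and> K m \<subseteq> \<Union>\<V> \<and> (\<forall>V\<in>\<V>. \<forall>x\<in>V. \<forall>y\<in>V. mdist Y x y < e)"
      by (intro exI[of _ "W ` {k j..<k (Suc j)}"]) auto
  qed
  have compK: "compactin (mtopology_of Y) (K m)" for m
    using tbK[of m] closedK[of m] comp
    by (simp add: Y.mtotally_bounded_eq_compact_closure_of closure_of_closedin mtopology_of_def)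
  have fK: "f ` mspace X \<subseteq> (\<Union>m. K m)"
  proof clarify
    fix x assume x: "x \<in> mspace X"
    then have "finite {j. x \<notin> (\<Union>n\<in>{k j..<k (Suc j)}. U n)}"
      using gam by (simp add: gamma_cover_def)
    from finite_nat_bounded[OF this] obtain m
      where m: "{j. x \<notin> (\<Union>n\<in>{k j..<k (Suc j)}. U n)} \<subseteq> {..<m}" ..
    have "f x \<in> V j" if "j \<ge> m" for j
    proof -
      have "x \<in> (\<Union>n\<in>{k j..<k (Suc j)}. U n)"
        using subsetD[OF m, of j] \<open>j \<ge> m\<close> by (simp only: mem_Collect_eq lessThan_iff) linarith
      then obtain n where n: "n \<in> {k j..<k (Suc j)}" "x \<in> U n" by blast
      have "f ` U n \<subseteq> W n"
        unfolding W_def using U fY by (intro closure_of_subset) auto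
      then show ?thesis using n unfolding V_def by blast
    qed
    then show "f x \<in> (\<Union>m. K m)" by (auto simp: K_def)
  qed
  \<comment> \<open>Covering the \<open>m\<close>-th compact piece by the group with index \<open>J + m\<close> uses every \<open>W n\<close> at most
    once, so the whole union is covered by a tail of the sequence \<open>W\<close>.\<close>
  have tail: "(\<Union>m. K m) \<subseteq> (\<Union>n. W (n + k J))" for J
  proof clarify
    fix m x assume "x \<in> K m"
    then have "x \<in> V (J + m)" by (auto simp: K_def)
    then obtain n where n: "k (J + m) \<le> n" "x \<in> W n" by (auto simp: V_def)
    have "k J \<le> k (J + m)" using k(2) by (simp add: strict_mono_less_eq)
    then have "x \<in> W ((n - k J) + k J)" using n by simp
    then show "x \<in> (\<Union>n. W (n + k J))" by blast
  qed
  have "hausdorff_dim Y (\<Union>m. K m) = 0"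
  proof (intro hausdorff_dim_eq_0I hausdorff_measure_eq_0I)
    fix s d e :: real assume "s > 0" "d > 0" "e > 0"
    \<comment> \<open>The \<open>s\<close>-th powers of the diameters are dominated by a geometric
      series with ratio \<open>q\<close>.\<close>
    define q where "q = (1/2::real) powr s"
    have q: "0 < q" "q < 1" using powr_less_mono2[of s "1/2" 1] \<open>s > 0\<close> by (auto simp: q_def)
    \<comment> \<open>The first bound makes the tail sum \<open>q ^ J / (1 - q)\<close> smaller than
      \<open>e\<close>; the second makes all diameters in the tail smaller than
      \<open>d\<close>.\<close>
    obtain J where J: "q ^ J < e * (1 - q)" "(1/2) ^ J < d"
    proof -
      obtain J1 where J1: "q ^ J1 < e * (1 - q)"
        using real_arch_pow_inv[of "e * (1 - q)" q] q \<open>e > 0\<close> by auto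
      obtain J2 where J2: "(1/2) ^ J2 < d"
        using real_arch_pow_inv[of d "1/2"] \<open>d > 0\<close> by auto
      have "q ^ max J1 J2 \<le> q ^ J1" "(1/2::real) ^ max J1 J2 \<le> (1/2) ^ J2"
        using q by (auto intro!: power_decreasing)
      then show ?thesis using J1 J2 that[of "max J1 J2"] by linarith
    qed
    define C where "C n = W (n + k J)" for n
    have diamC: "mdiam Y (C n) \<le> ennreal ((1/2)^(n + k J))" for n
      unfolding C_def by (subst mdiam_le_iff) (auto intro: Wd)
    have "mdiam Y (C n) \<le> ennreal d" for n
    proof -
      have "(1/2::real)^(n + k J) \<le> (1/2)^J"
        using kge[of J] by (intro power_decreasing) auto
      then have "ennreal ((1/2)^(n + k J)) \<le> ennreal d" using J by (intro ennreal_leI) linarith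
      then show ?thesis using diamC[of n] by (meson order_trans)
    qed
    moreover have "(\<Sum>n. ennreal (enn2real (mdiam Y (C n)) powr s)) \<le> ennreal e"
    proof -
      have "enn2real (mdiam Y (C n)) powr s \<le> q ^ J * q ^ n" for n
      proof -
        have "enn2real (mdiam Y (C n)) \<le> (1/2)^(n + k J)"
          using diamC[of n] by (simp add: enn2real_leI)
        then have "enn2real (mdiam Y (C n)) powr s \<le> ((1/2)^(n + k J)) powr s"
          using \<open>s > 0\<close> by (intro powr_mono2) auto
        also have "\<dots> = q ^ (n + k J)"
          by (simp add: q_def powr_powr mult.commute flip: powr_realpow)
        also have "\<dots> \<le> q ^ (n + J)" using kge[of J] q by (intro power_decreasing) auto
        finally show ?thesis by (simp add: power_add mult.commute)
      qed
      then have "(\<Sum>n. ennreal (enn2real (mdiam Y (C n)) powr s)) \<le> (\<Sum>n. ennreal (q ^ J * q ^ n))"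
        by (intro suminf_le ennreal_leI) auto
      also have "\<dots> = ennreal (q ^ J * (1 / (1 - q)))"
        using q by (intro suminf_ennreal_eq sums_mult geometric_sums) auto
      also have "\<dots> \<le> ennreal e"
        using J q by (intro ennreal_leI) (simp add: field_simps)
      finally show ?thesis .
    qed
    ultimately show "\<exists>C. (\<forall>n. C n \<subseteq> mspace Y \<and> mdiam Y (C n) \<le> ennreal d) \<and> (\<Union>m. K m) \<subseteq> (\<Union>n. C n) \<and>
        (\<Sum>n. ennreal (enn2real (mdiam Y (C n)) powr s)) \<le> ennreal e"
      using WY tail[of J] by (intro exI[of _ C]) (auto simp: C_def)
  qed
  then show "\<exists>K. K \<subseteq> mspace Y \<and> sigma_compactin (mtopology_of Y) K \<and> f ` mspace X \<subseteq> K \<and> hausdorff_dim Y K = 0"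
    using fK KY compK by (intro exI[of _ "\<Union>m. K m"]) (auto simp: sigma_compactin_def)
qed

section \<open>Finite covers of compact sets with small sum of diameters\<close>

text \<open>In decreasing order the first \<open>i + 1\<close> values are all at least the one at
  position \<open>i\<close>, so \<open>i + 1\<close> times that value is at most the sum. The
  induction puts a minimal element last and orders the remaining ones first.\<close>

lemma enumeration_Suc_mult_le_sum:
  fixes t :: "'i \<Rightarrow> real"
  assumes "finite S" and "\<And>x. x \<in> S \<Longrightarrow> t x \<ge> 0"
  shows "\<exists>\<pi>. \<pi> ` {..<card S} = S \<and> (\<forall>i<card S. real (Suc i) * t (\<pi> i) \<le> sum t S)"
  using assms
proof (induction "card S" arbitrary: S)
  case 0
  then show ?case by auto
next
  case (Suc n)
  define a where "a = arg_min_on t S"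
  have "S \<noteq> {}" using Suc.hyps(2) by auto
  have a: "a \<in> S" "\<And>x. x \<in> S \<Longrightarrow> t a \<le> t x"
    using arg_min_if_finite[OF \<open>finite S\<close> \<open>S \<noteq> {}\<close>, of t] unfolding a_def by (auto simp: not_less)
  define S' where "S' = S - {a}"
  have card: "n = card S'" using Suc a by (simp add: S'_def)
  obtain \<pi> where \<pi>: "\<pi> ` {..<n} = S'" "\<And>i. i < n \<Longrightarrow> real (Suc i) * t (\<pi> i) \<le> sum t S'"
    using Suc.hyps(1)[OF card] Suc.prems card by (auto simp: S'_def)
  define \<rho> where "\<rho> = \<pi>(n := a)"
  have "\<rho> ` {..<Suc n} = S"
    using \<pi>(1) a by (auto simp: \<rho>_def lessThan_Suc S'_def)
  moreover have "real (Suc i) * t (\<rho> i) \<le> sum t S" if "i < Suc n" for i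
  proof (cases "i = n")
    case True
    have "real (card S) * t a \<le> sum t S" using a by (intro sum_bounded_below) auto
    then show ?thesis using True Suc.hyps(2) by (simp add: \<rho>_def)
  next
    case False
    then have "real (Suc i) * t (\<rho> i) \<le> sum t S'" using \<pi>(2)[of i] that by (simp add: \<rho>_def)
    also have "\<dots> \<le> sum t S" using Suc.prems by (intro sum_mono2) (auto simp: S'_def)
    finally show ?thesis .
  qed
  ultimately show ?case using Suc.hyps(2) by (intro exI[of _ \<rho>]) auto
qed

text \<open>Dimension 0 yields an exponent \<open>s < 1\<close> with measure 0. Using scale 1 keeps
  every diameter \<open>r\<close> at most 1, where \<open>r \<le> r powr s\<close>, so a small sum
  of powers bounds the sum of diameters. Bounding all finite partial sums keeps the statement within
  the reals.\<close>

lemma hausdorff_dim_0_cover: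
  assumes "hausdorff_dim m K = 0" and "e > 0"
  obtains E :: "nat \<Rightarrow> 'a set" and r :: "nat \<Rightarrow> real"
  where "\<And>n. E n \<subseteq> mspace m" "K \<subseteq> (\<Union>n. E n)" "\<And>n. r n \<ge> 0"
    "\<And>n x y. x \<in> E n \<Longrightarrow> y \<in> E n \<Longrightarrow> mdist m x y \<le> r n"
    "\<And>N. (\<Sum>n<N. r n) < e"
proof -
  have "hausdorff_dim m K < ennreal 1" using assms(1) by simp
  then obtain s where s: "s > 0" "ennreal s < ennreal 1" "hausdorff_measure m (\<lambda>r. r powr s) K = 0"
    unfolding hausdorff_dim_def Inf_less_iff by blast
  then have "s < 1" by (simp add: ennreal_less_iff)
  have "(INF C\<in>{C :: nat \<Rightarrow> 'a set. (\<forall>n. C n \<subseteq> mspace m \<and> mdiam m (C n) \<le> ennreal 1) \<and> K \<subseteq> (\<Union>n. C n)}.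
        \<Sum>n. ennreal (enn2real (mdiam m (C n)) powr s)) \<le> hausdorff_measure m (\<lambda>r. r powr s) K"
    unfolding hausdorff_measure_def by (rule SUP_upper) simp
  also have "\<dots> < ennreal e" using s assms by simp
  finally obtain E :: "nat \<Rightarrow> 'a set" where E: "\<forall>n. E n \<subseteq> mspace m \<and> mdiam m (E n) \<le> ennreal 1"
    "K \<subseteq> (\<Union>n. E n)" and Esum: "(\<Sum>n. ennreal (enn2real (mdiam m (E n)) powr s)) < ennreal e"
    unfolding INF_less_iff by blast
  define r where "r n = enn2real (mdiam m (E n))" for n
  have r: "0 \<le> r n" "r n \<le> 1" "mdiam m (E n) = ennreal (r n)" for n
  proof -
    have le: "mdiam m (E n) \<le> ennreal 1" using E by simp
    then have "mdiam m (E n) < top" by (rule le_less_trans) simp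
    then show "mdiam m (E n) = ennreal (r n)" by (simp add: r_def)
    show "0 \<le> r n" by (simp add: r_def)
    show "r n \<le> 1" unfolding r_def using le by (intro enn2real_leI) auto
  qed
  have "mdist m x y \<le> r n" if "x \<in> E n" "y \<in> E n" for n x y
    using mdiam_le_iff[OF r(1), of m "E n" n] r(3)[of n] that by simp
  moreover have "(\<Sum>n<N. r n) < e" for N
  proof -
    have "r n \<le> r n powr s" for n
      using powr_mono'[of s 1 "r n"] r[of n] \<open>s < 1\<close> by simp
    then have "ennreal (\<Sum>n<N. r n) \<le> ennreal (\<Sum>n<N. r n powr s)"
      by (intro ennreal_leI sum_mono)
    also have "\<dots> = (\<Sum>n<N. ennreal (r n powr s))" by simp
    also have "\<dots> \<le> (\<Sum>n. ennreal (r n powr s))" by (intro sum_le_suminf) auto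
    also have "\<dots> < ennreal e" using Esum by (simp add: r_def)
    finally show ?thesis using r(1) by (subst (asm) ennreal_less_iff) (auto intro: sum_nonneg)
  qed
  ultimately show ?thesis using that[of E r] E r(1) by blast
qed

text \<open>The sets covering \<open>K\<close> need not be open. Each is enlarged to an open
  neighbourhood with radii of small total sum, and compactness then leaves finitely many of
  them.\<close>

lemma compactin_hausdorff_dim_0_finite_cover:
  assumes C: "compactin (mtopology_of m) C" "C \<subseteq> K" and K: "hausdorff_dim m K = 0" and "e > 0"
  obtains G :: "nat \<Rightarrow> 'a set" and t :: "nat \<Rightarrow> real" and N :: nat
  where "N > 0" "C \<subseteq> (\<Union>n<N. G n)" "\<forall>n. t n \<ge> 0"
    "\<forall>n. \<forall>x\<in>G n. \<forall>y\<in>G n. mdist m x y \<le> t n" "(\<Sum>n<N. t n) < e"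
proof -
  interpret Metric_space "mspace m" "mdist m" by simp
  have "e / 2 > 0" using \<open>e > 0\<close> by simp
  from hausdorff_dim_0_cover[OF K this] obtain E :: "nat \<Rightarrow> 'a set" and r
    where E: "\<And>n. E n \<subseteq> mspace m" "K \<subseteq> (\<Union>n. E n)" and r: "\<And>n. r n \<ge> 0"
      "\<And>n x y. x \<in> E n \<Longrightarrow> y \<in> E n \<Longrightarrow> mdist m x y \<le> r n" "\<And>N. (\<Sum>n<N. r n) < e / 2"
    by blast
  \<comment> \<open>Enlarging by \<open>\<rho> n\<close> adds at most \<open>2 * \<rho> n\<close> to
    the diameter bound. These additions sum to at most \<open>e / 2\<close>, which is what the bound
    \<open>e / 2\<close> on the sums of \<open>r\<close> leaves over.\<close>
  define \<rho> where "\<rho> n = e / 8 * (1/2)^n" for n :: nat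
  define t where "t n = r n + 2 * \<rho> n" for n
  define G where "G n = (\<Union>x\<in>E n. mball x (\<rho> n))" for n
  have \<rho>: "\<rho> n > 0" for n using \<open>e > 0\<close> by (simp add: \<rho>_def)
  have "mdist m x y \<le> t n" if "x \<in> G n" "y \<in> G n" for x y n
  proof -
    obtain a b where ab: "a \<in> E n" "b \<in> E n" "mdist m a x < \<rho> n" "mdist m b y < \<rho> n"
      and M: "x \<in> mspace m" "y \<in> mspace m" "a \<in> mspace m" "b \<in> mspace m"
    proof -
      have *: "\<exists>a\<in>E n. mdist m a z < \<rho> n \<and> z \<in> mspace m \<and> a \<in> mspace m" if "z \<in> G n" for z
        using that by (auto simp: G_def)
      show thesis using *[OF \<open>x \<in> G n\<close>] *[OF \<open>y \<in> G n\<close>] that by blast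
    qed
    have "mdist m x y \<le> mdist m x a + mdist m a y" "mdist m a y \<le> mdist m a b + mdist m b y"
      using M by (auto intro: mdist_triangle)
    moreover have "mdist m x a = mdist m a x" using M by (simp add: mdist_commute)
    ultimately show ?thesis using ab r(2)[of a n b] by (simp add: t_def)
  qed
  then have G: "\<forall>n. \<forall>x\<in>G n. \<forall>y\<in>G n. mdist m x y \<le> t n" by blast
  have "openin mtopology U" if "U \<in> range G" for U
    using that by (auto simp: G_def intro!: openin_Union)
  moreover have "C \<subseteq> \<Union>(range G)"
  proof
    fix x assume "x \<in> C"
    then obtain n where n: "x \<in> E n" using C E by blast
    then have "x \<in> mball x (\<rho> n)" using E(1)[of n] \<rho>[of n] by auto
    then show "x \<in> \<Union>(range G)" using n by (auto simp: G_def)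
  qed
  ultimately obtain \<F> where \<F>: "finite \<F>" "\<F> \<subseteq> range G" "C \<subseteq> \<Union>\<F>"
    using C(1) unfolding compactin_def mtopology_of_def by metis
  then obtain I where I: "finite I" "\<F> = G ` I" by (meson finite_subset_image)
  from finite_nat_bounded[OF I(1)] obtain N0 where N0: "I \<subseteq> {..<N0}" ..
  \<comment> \<open>The successor keeps \<open>N\<close> positive even for empty \<open>C\<close>;
    the groups formed later then have nonempty index intervals.\<close>
  define N where "N = Suc N0"
  have "C \<subseteq> (\<Union>n<N. G n)"
  proof
    fix x assume "x \<in> C"
    then obtain n where "n \<in> I" "x \<in> G n" using \<F> I by blast
    then show "x \<in> (\<Union>n<N. G n)" using N0 by (force simp: N_def)
  qed
  moreover have "(\<Sum>n<N. t n) < e"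
  proof -
    have "(\<Sum>n<N. 2 * \<rho> n) = e / 4 * (\<Sum>n<N. (1/2)^n)"
      by (simp add: \<rho>_def sum_distrib_left)
    also have "(\<Sum>n<N. (1/2::real)^n) = 2 - 2 * (1/2)^N"
      by (simp add: sum_gp_strict)
    also have "e / 4 * \<dots> \<le> e / 4 * 2" using \<open>e > 0\<close> by (intro mult_left_mono) auto
    finally show ?thesis using r(3)[of N] by (simp add: t_def sum.distrib)
  qed
  moreover have "\<forall>n. t n \<ge> 0" using r(1) \<rho> by (simp add: t_def less_imp_le)
  moreover have "N > 0" by (simp add: N_def)
  ultimately show ?thesis using G by (intro that[of N G t])
qed

section \<open>A uniformly continuous map into the bounded sequences\<close>

text \<open>This map is the one to which sharp measure zero gets applied. Its second property pulls
  image sets of diameter below \<open>1 / (n + 1)\<close> back to sets of diameter at most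
  \<open>\<epsilon> n\<close>, for all \<open>n\<close> at once.\<close>

lemma separable_uniform_map_bcontfun:
  fixes X :: "'a metric" and \<epsilon> :: "nat \<Rightarrow> real"
  assumes separable: "separable_space (mtopology_of X)" and "mspace X \<noteq> {}" and \<epsilon>: "\<And>n. \<epsilon> n > 0"
  obtains F :: "'a \<Rightarrow> nat \<Rightarrow>\<^sub>C real"
  where "\<And>e. e > 0 \<Longrightarrow> \<exists>\<delta>>0. \<forall>x\<in>mspace X. \<forall>y\<in>mspace X. mdist X x y < \<delta> \<longrightarrow> dist (F x) (F y) < e"
    and "\<And>x y n. x \<in> mspace X \<Longrightarrow> y \<in> mspace X \<Longrightarrow> dist (F x) (F y) < 1 / real (Suc n) \<Longrightarrow> mdist X x y \<le> \<epsilon> n"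
proof -
  interpret Metric_space "mspace X" "mdist X" by simp
  obtain Q where Q: "countable Q" "Q \<subseteq> mspace X" "mtopology_of X closure_of Q = mspace X"
    using separable by (auto simp: separable_space_def)
  have "Q \<noteq> {}" using Q \<open>mspace X \<noteq> {}\<close> by auto
  define q where "q = from_nat_into Q"
  have q: "q n \<in> mspace X" for n
    using Q \<open>Q \<noteq> {}\<close> from_nat_into[of Q n] by (auto simp: q_def)
  have dense: "\<exists>n. mdist X x (q n) < e" if "x \<in> mspace X" "e > 0" for x e
  proof -
    have "x \<in> mtopology closure_of Q" using Q(3) that by (simp add: mtopology_of_def)
    then obtain y where "y \<in> Q" "mdist X x y < e"
      using \<open>e > 0\<close> unfolding metric_closure_of by auto
    then show ?thesis using from_nat_into_surj[OF Q(1)] unfolding q_def by blast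
  qed
  define c where "c k = 1 / real (Suc k)" for k
  have c: "0 < c k" "c k \<le> 1" for k by (auto simp: c_def)
  \<comment> \<open>Since \<open>c k \<le> 1\<close>, the coordinate reaches its cap
    \<open>c k\<close> as soon as \<open>x\<close> has distance at least \<open>\<epsilon> k\<close>
    from \<open>q n\<close>. The caps tend to 0, so only finitely many \<open>k\<close> matter at a
    given scale.\<close>
  define \<phi> where "\<phi> x k n = min (c k) (mdist X x (q n) / \<epsilon> k)" for x k n
  define F :: "'a \<Rightarrow> nat \<Rightarrow>\<^sub>C real"
    where "F x = Bcontfun (\<lambda>i. \<phi> x (fst (prod_decode i)) (snd (prod_decode i)))" for x
  have \<phi>: "0 \<le> \<phi> x k n" "\<phi> x k n \<le> c k" for x k n
    using c[of k] \<epsilon>[of k] by (auto simp: \<phi>_def)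
  have F: "apply_bcontfun (F x) i = \<phi> x (fst (prod_decode i)) (snd (prod_decode i))" for x i
  proof -
    have "norm (\<phi> x k n) \<le> 1" for k n
      using \<phi>[of x k n] c(2)[of k] by simp
    then have "(\<lambda>i. \<phi> x (fst (prod_decode i)) (snd (prod_decode i))) \<in> bcontfun"
      by (intro bcontfun_normI[where b = 1]) auto
    then show ?thesis unfolding F_def by (simp add: Bcontfun_inverse)
  qed
  have Fdist: "\<bar>\<phi> x k n - \<phi> y k n\<bar> \<le> dist (F x) (F y)" for x y k n
    using dist_bounded[of "F x" "prod_encode (k, n)" "F y"] by (simp add: F dist_real_def)
  have 1: "\<exists>\<delta>>0. \<forall>x\<in>mspace X. \<forall>y\<in>mspace X. mdist X x y < \<delta> \<longrightarrow> dist (F x) (F y) < e" if "e > 0" for e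
  proof -
    obtain N where N: "c N < e / 2"
      using reals_Archimedean[of "e / 2"] \<open>e > 0\<close> by (auto simp: c_def inverse_eq_divide)
    \<comment> \<open>For \<open>k \<le> N\<close> the coordinates are Lipschitz with constant
      \<open>1 / \<epsilon> k \<le> 1 / \<mu>\<close>, whence the modulus
      \<open>e / 2 * \<mu>\<close>. For \<open>k > N\<close> both values lie between 0 and
      \<open>c N < e / 2\<close>.\<close>
    define \<mu> where "\<mu> = Min (\<epsilon> ` {..N})"
    have "\<mu> > 0" using \<epsilon> by (simp add: \<mu>_def)
    have \<mu>: "\<mu> \<le> \<epsilon> k" if "k \<le> N" for k using that by (simp add: \<mu>_def)
    have "dist (F x) (F y) < e" if xy: "x \<in> mspace X" "y \<in> mspace X" and d: "mdist X x y < e / 2 * \<mu>" for x y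
    proof -
      have "\<bar>\<phi> x k n - \<phi> y k n\<bar> \<le> e / 2" for k n
      proof (cases "k \<le> N")
        case True
        have "\<bar>mdist X x (q n) - mdist X y (q n)\<bar> \<le> mdist X x y"
          using mdist_triangle[of x X y "q n"] mdist_triangle[of y X x "q n"] xy q[of n] commute[of x y]
          by (simp add: abs_le_iff)
        then have "\<bar>mdist X x (q n) / \<epsilon> k - mdist X y (q n) / \<epsilon> k\<bar> \<le> mdist X x y / \<epsilon> k"
          using \<epsilon>[of k] by (simp add: divide_right_mono flip: diff_divide_distrib)
        moreover have "mdist X x y / \<epsilon> k \<le> e / 2"
        proof -
          have "e / 2 * \<mu> \<le> e / 2 * \<epsilon> k" using \<mu>[OF True] \<open>e > 0\<close> by (intro mult_left_mono) auto
          then have "mdist X x y \<le> e / 2 * \<epsilon> k" using d by linarith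
          then show ?thesis using \<epsilon>[of k] by (simp add: pos_divide_le_eq)
        qed
        ultimately show ?thesis unfolding \<phi>_def by linarith
      next
        case False
        then have "c k \<le> c N" by (simp add: c_def field_simps)
        then show ?thesis using \<phi>[of x k n] \<phi>[of y k n] N by linarith
      qed
      then have "dist (F x) (F y) \<le> e / 2"
        by (intro dist_bound) (simp add: F dist_real_def)
      then show ?thesis using \<open>e > 0\<close> by linarith
    qed
    then show ?thesis using \<open>e > 0\<close> \<open>\<mu> > 0\<close> by (intro exI[of _ "e / 2 * \<mu>"]) auto
  qed
  have 2: "mdist X x y \<le> \<epsilon> k" if xy: "x \<in> mspace X" "y \<in> mspace X" and d: "dist (F x) (F y) < c k" for x y k
  proof (rule ccontr)
    assume neg: "\<not> mdist X x y \<le> \<epsilon> k"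
    \<comment> \<open>A point \<open>q n\<close> within \<open>\<tau>\<close> of \<open>y\<close>
      separates the images: the first term keeps it at distance at least \<open>\<epsilon> k\<close>
      from \<open>x\<close>, so the coordinate of \<open>x\<close> is at its cap, and the second
      pushes the coordinate of \<open>y\<close> below \<open>c k - dist (F x) (F y)\<close>. The two
      coordinates then differ by more than the sup distance.\<close>
    define \<tau> where "\<tau> = min (mdist X x y - \<epsilon> k) (\<epsilon> k * (c k - dist (F x) (F y)))"
    have "\<tau> > 0" using neg d \<epsilon>[of k] by (simp add: \<tau>_def)
    then obtain n where n: "mdist X y (q n) < \<tau>" using dense xy by blast
    have "mdist X x y \<le> mdist X x (q n) + mdist X (q n) y" using xy q by (intro mdist_triangle) auto
    then have "mdist X x (q n) \<ge> \<epsilon> k" using n commute[of "q n" y] unfolding \<tau>_def by linarith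
    then have "mdist X x (q n) / \<epsilon> k \<ge> 1" using \<epsilon>[of k] by (simp add: le_divide_eq)
    then have "\<phi> x k n = c k" using c(2)[of k] by (simp add: \<phi>_def)
    moreover have "\<phi> y k n < c k - dist (F x) (F y)"
    proof -
      have "mdist X y (q n) < (c k - dist (F x) (F y)) * \<epsilon> k" using n by (simp add: \<tau>_def mult.commute)
      then have "mdist X y (q n) / \<epsilon> k < c k - dist (F x) (F y)"
        using \<epsilon>[of k] by (simp add: pos_divide_less_eq)
      then show ?thesis by (simp add: \<phi>_def)
    qed
    ultimately show False using Fdist[of x k n y] by linarith
  qed
  show ?thesis using that[of F] 1 2 unfolding c_def by blast
qed

section \<open>Transfer of the sequence space to another carrier type\<close>

text \<open>Coding each real as a set of naturals turns a sequence of reals into a set of pairs of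
  naturals, hence into one set of naturals, and there are continuum many of those.\<close>

lemma UNIV_bcontfun_lepoll_reals: "(UNIV :: (nat \<Rightarrow>\<^sub>C real) set) \<lesssim> (UNIV :: real set)"
proof -
  have "(UNIV :: real set) \<lesssim> (UNIV :: nat set set)"
    using nat_sets_eqpoll_reals eqpoll_imp_lepoll eqpoll_sym by blast
  then obtain h :: "real \<Rightarrow> nat set" where h: "inj h" by (auto simp: lepoll_def)
  define code :: "(nat \<Rightarrow>\<^sub>C real) \<Rightarrow> nat set"
    where "code u = {i. snd (prod_decode i) \<in> h (apply_bcontfun u (fst (prod_decode i)))}" for u
  have "inj code"
  proof (rule injI)
    fix u v assume eq: "code u = code v"
    show "u = v"
    proof (rule bcontfun_eqI)
      fix n
      have "m \<in> h (apply_bcontfun u n) \<longleftrightarrow> m \<in> h (apply_bcontfun v n)" for m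
        by (metis (mono_tags, lifting) code_def eq fst_conv mem_Collect_eq prod_encode_inverse snd_conv)
      then have "h (apply_bcontfun u n) = h (apply_bcontfun v n)" by blast
      then show "apply_bcontfun u n = apply_bcontfun v n" using h by (simp add: inj_eq)
    qed
  qed
  then have "(UNIV :: (nat \<Rightarrow>\<^sub>C real) set) \<lesssim> (UNIV :: nat set set)" by (auto simp: lepoll_def)
  then show ?thesis
    using nat_sets_eqpoll_reals eqpoll_imp_lepoll lepoll_trans by blast
qed

text \<open>
  The library instance of completeness for bounded continuous functions demands a metric domain,
  and \<open>nat\<close> is only a topological space.
\<close>

lemma Cauchy_imp_convergent_bcontfun:
  fixes u :: "nat \<Rightarrow> 'a::topological_space \<Rightarrow>\<^sub>C 'b::complete_space"
  assumes "Cauchy u"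
  shows "convergent u"
proof -
  have "uniformly_Cauchy_on UNIV (\<lambda>n. apply_bcontfun (u n))"
  proof (rule uniformly_Cauchy_onI)
    fix e :: real assume "e > 0"
    then obtain M where "\<forall>m\<ge>M. \<forall>n\<ge>M. dist (u m) (u n) < e"
      using metric_CauchyD[OF assms] by blast
    then show "\<exists>M. \<forall>x\<in>UNIV. \<forall>m\<ge>M. \<forall>n\<ge>M. dist (apply_bcontfun (u m) x) (apply_bcontfun (u n) x) < e"
      by (meson dist_fun_lt_imp_dist_val_lt)
  qed
  then obtain l where "uniform_limit UNIV (\<lambda>n. apply_bcontfun (u n)) l sequentially"
    using Cauchy_uniformly_convergent unfolding uniformly_convergent_on_def by blast
  then show ?thesis
    using uniform_limit_bcontfunE[OF _ sequentially_bot] unfolding convergent_def by metis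
qed

text \<open>The targets in \<open>sharp_measure_zero\<close> are carried by a fixed type, so the
  complete sequence space has to be copied into it along an injection.\<close>

lemma complete_metric_on_range:
  fixes g :: "'c::metric_space \<Rightarrow> 'b"
  assumes "inj g" and complete: "\<And>u :: nat \<Rightarrow> 'c. Cauchy u \<Longrightarrow> convergent u"
  obtains Y :: "'b metric"
  where "mspace Y = range g" "mcomplete_of Y" "\<forall>u v. mdist Y (g u) (g v) = dist u v"
proof -
  define d where "d a b = dist (inv g a) (inv g b)" for a b
  have d: "d (g u) (g v) = dist u v" for u v using assms by (simp add: d_def)
  interpret Metric_space "range g" d
  proof
    show "0 \<le> d x y" "d x y = d y x" for x y by (auto simp: d_def dist_commute)
    show "(d x y = 0) = (x = y)" if "x \<in> range g" "y \<in> range g" for x y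
      using that d assms by (auto simp: inj_eq)
    show "d x z \<le> d x y + d y z" for x y z by (simp add: d_def dist_triangle)
  qed
  have "mcomplete"
    unfolding mcomplete_def
  proof (intro allI impI)
    fix \<sigma> assume \<sigma>: "MCauchy \<sigma>"
    define u where "u n = inv g (\<sigma> n)" for n
    have gu: "\<sigma> n = g (u n)" for n
    proof -
      have "\<sigma> n \<in> range g" using \<sigma> by (auto simp: MCauchy_def)
      then show ?thesis by (simp add: u_def f_inv_into_f)
    qed
    have "Cauchy u"
    proof (rule metric_CauchyI)
      fix e :: real assume "e > 0"
      then obtain N where "\<forall>n n'. N \<le> n \<longrightarrow> N \<le> n' \<longrightarrow> d (\<sigma> n) (\<sigma> n') < e"
        using \<sigma> unfolding MCauchy_def by meson
      then show "\<exists>M. \<forall>m\<ge>M. \<forall>n\<ge>M. dist (u m) (u n) < e"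
        by (auto simp: gu d)
    qed
    from complete[OF this] obtain l where l: "u \<longlonglongrightarrow> l" unfolding convergent_def ..
    have "limitin mtopology \<sigma> (g l) sequentially"
      unfolding limitin_metric using l by (auto simp: gu d tendsto_iff)
    then show "\<exists>x. limitin mtopology \<sigma> x sequentially" by blast
  qed
  then show ?thesis using that[of "metric (range g, d)"] d by simp
qed

section \<open>From sharp measure zero to groupable covers\<close>

lemma gamma_groupable_covers_if_sharp_measure_zero:
  fixes X :: "'a metric" and \<epsilon> :: "nat \<Rightarrow> real"
  assumes separable: "separable_space (mtopology_of X)"
    and universe: "(UNIV :: real set) \<lesssim> (UNIV :: 'b set)"
    and sharp: "sharp_measure_zero TYPE('b) X"
    and \<epsilon>: "\<And>n. \<epsilon> n > 0"
  shows "\<exists>U :: nat \<Rightarrow> 'a set. (\<forall>n. U n \<subseteq> mspace X \<and> mdiam X (U n) \<le> ennreal (\<epsilon> n)) \<and>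
        gamma_groupable_cover (mspace X) U"
proof (cases "mspace X = {}")
  case True
  then show ?thesis
    by (intro exI[of _ "\<lambda>n. {}"])
      (auto simp: mdiam_def gamma_groupable_cover_def gamma_cover_def strict_mono_def intro: exI[of _ "\<lambda>n. n"])
next
  case False
  obtain F :: "'a \<Rightarrow> nat \<Rightarrow>\<^sub>C real"
    where F: "\<And>e. e > 0 \<Longrightarrow> \<exists>\<delta>>0. \<forall>x\<in>mspace X. \<forall>y\<in>mspace X. mdist X x y < \<delta> \<longrightarrow> dist (F x) (F y) < e"
      and F\<epsilon>: "\<And>x y n. x \<in> mspace X \<Longrightarrow> y \<in> mspace X \<Longrightarrow> dist (F x) (F y) < 1 / real (Suc n) \<Longrightarrow> mdist X x y \<le> \<epsilon> n"
    using separable_uniform_map_bcontfun[of X \<epsilon>] separable False \<epsilon> by blast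
  obtain g :: "(nat \<Rightarrow>\<^sub>C real) \<Rightarrow> 'b" where "inj g"
    using lepoll_trans[OF UNIV_bcontfun_lepoll_reals universe] by (auto simp: lepoll_def)
  obtain Y :: "'b metric"
    where Y: "mspace Y = range g" "mcomplete_of Y" "\<forall>u v. mdist Y (g u) (g v) = dist u v"
    by (rule complete_metric_on_range[OF \<open>inj g\<close> Cauchy_imp_convergent_bcontfun])
  define f where "f x = g (F x)" for x
  have f: "uniformly_continuous_map X Y f"
    using F by (simp add: uniformly_continuous_map_def f_def Y) meson
  then obtain K where K: "sigma_compactin (mtopology_of Y) K" "f ` mspace X \<subseteq> K" "hausdorff_dim Y K = 0"
    using sharp Y(2) unfolding sharp_measure_zero_def by blast
  obtain C :: "nat \<Rightarrow> 'b set" where C: "\<forall>n. compactin (mtopology_of Y) (C n)" "K = (\<Union>n. C n)"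
    using K(1) unfolding sigma_compactin_def by (elim exE conjE)
  \<comment> \<open>Increasing unions ensure that a point of \<open>C m\<close> is covered by every
    group from the \<open>m\<close>-th on, as a gamma-cover demands.\<close>
  define D where "D j = (\<Union>i\<le>j. C i)" for j :: nat
  have D: "compactin (mtopology_of Y) (D j)" "D j \<subseteq> K" for j
    unfolding D_def using C by (auto intro!: compactin_Union)
  \<comment> \<open>The \<open>i\<close>-th largest of finitely many diameters with sum below \<open>1 / (k + 1)\<close> is less than
    \<open>1 / ((k + 1) (i + 1)) \<le> 1 / (k + i + 1)\<close>.\<close>
  have "\<exists>N G. N > 0 \<and> D j \<subseteq> (\<Union>i<N. G i) \<and>
      (\<forall>i<N. \<forall>x\<in>G i. \<forall>y\<in>G i. mdist Y x y < 1 / real (Suc (k + i)))" for j k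
  proof -
    have pos: "1 / real (Suc k) > 0" by simp
    obtain G :: "nat \<Rightarrow> 'b set" and t N where N: "N > 0" and G: "D j \<subseteq> (\<Union>n<N. G n)" and t: "\<forall>n. t n \<ge> 0"
      and Gt: "\<forall>n. \<forall>x\<in>G n. \<forall>y\<in>G n. mdist Y x y \<le> t n" and sum: "(\<Sum>n<N. t n) < 1 / real (Suc k)"
      by (rule compactin_hausdorff_dim_0_finite_cover[OF D(1)[of j] D(2) K(3) pos])
    obtain \<pi> where \<pi>: "\<pi> ` {..<N} = {..<N}" "\<And>i. i < N \<Longrightarrow> real (Suc i) * t (\<pi> i) \<le> (\<Sum>n<N. t n)"
      using enumeration_Suc_mult_le_sum[of "{..<N}" t] t by auto
    have "mdist Y x y < 1 / real (Suc (k + i))" if "i < N" "x \<in> G (\<pi> i)" "y \<in> G (\<pi> i)" for i x y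
    proof -
      have "real (Suc i) * t (\<pi> i) < 1 / real (Suc k)" using \<pi>(2)[OF \<open>i < N\<close>] sum by linarith
      then have *: "real (Suc k) * real (Suc i) * t (\<pi> i) < 1" by (simp add: field_simps)
      have "real (Suc (k + i)) \<le> real (Suc k) * real (Suc i)" by (simp add: algebra_simps)
      then have "real (Suc (k + i)) * t (\<pi> i) \<le> real (Suc k) * real (Suc i) * t (\<pi> i)"
        using t by (intro mult_right_mono) auto
      then have "t (\<pi> i) * real (Suc (k + i)) < 1" using * by (simp add: mult.commute)
      then have "t (\<pi> i) < 1 / real (Suc (k + i))" by (subst pos_less_divide_eq) auto
      moreover have "mdist Y x y \<le> t (\<pi> i)" using Gt that by blast
      ultimately show ?thesis by linarith
    qed
    moreover have "D j \<subseteq> (\<Union>i<N. G (\<pi> i))"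
      using G \<pi>(1) by (metis image_image)
    ultimately show ?thesis using N by (intro exI[of _ N] exI[of _ "\<lambda>i. G (\<pi> i)"]) auto
  qed
  then obtain N :: "nat \<Rightarrow> nat \<Rightarrow> nat" and G :: "nat \<Rightarrow> nat \<Rightarrow> nat \<Rightarrow> 'b set"
    where N: "\<And>j k. N j k > 0" and G: "\<And>j k. D j \<subseteq> (\<Union>i<N j k. G j k i)"
      and Gd: "\<And>j k i x y. i < N j k \<Longrightarrow> x \<in> G j k i \<Longrightarrow> y \<in> G j k i \<Longrightarrow> mdist Y x y < 1 / real (Suc (k + i))"
    by metis
  \<comment> \<open>The number of sets needed for \<open>D j\<close> depends on the index at which
    its group starts, because later sets have to be smaller. The endpoints are therefore defined by
    recursion.\<close>
  define k where "k = rec_nat 0 (\<lambda>j m. m + N j m)"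
  have k0: "k 0 = 0" and kSuc: "\<And>j. k (Suc j) = k j + N j (k j)" by (simp_all add: k_def)
  have k: "strict_mono k" using N by (auto intro!: strict_monoI_Suc simp: kSuc)
  have uniq: "j = j'" if "k j \<le> n" "n < k (Suc j)" "k j' \<le> n" "n < k (Suc j')" for n j j'
  proof -
    have "k j < k (Suc j')" "k j' < k (Suc j)" using that by linarith+
    then show ?thesis using k by (simp add: strict_mono_less)
  qed
  \<comment> \<open>The group index \<open>j\<close> is determined by \<open>n\<close>, as
    \<open>uniq\<close> shows, so \<open>U n\<close> is the preimage of a single set: the one at
    offset \<open>n - k j\<close> in the cover chosen for \<open>D j\<close>.\<close>
  define U where "U n = {x \<in> mspace X. \<exists>j. k j \<le> n \<and> n < k (Suc j) \<and> f x \<in> G j (k j) (n - k j)}" for n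
  have Ud: "mdist X x y \<le> \<epsilon> n" if xy: "x \<in> U n" "y \<in> U n" for x y n
  proof -
    obtain j where j: "k j \<le> n" "n < k (Suc j)" "f x \<in> G j (k j) (n - k j)"
      using xy(1) by (auto simp: U_def)
    obtain j' where j': "k j' \<le> n" "n < k (Suc j')" "f y \<in> G j' (k j') (n - k j')"
      using xy(2) by (auto simp: U_def)
    have "j' = j" using uniq j j' by blast
    \<comment> \<open>Starting index plus offset is \<open>n\<close>, so the bound is exactly the
      threshold \<open>1 / (n + 1)\<close> belonging to \<open>\<epsilon> n\<close>.\<close>
    then have "mdist Y (f x) (f y) < 1 / real (Suc (k j + (n - k j)))"
      using j j' by (intro Gd) (auto simp: kSuc)
    then have "dist (F x) (F y) < 1 / real (Suc n)" using j by (simp add: f_def Y)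
    then show ?thesis using F\<epsilon> xy by (simp add: U_def)
  qed
  have "gamma_cover (mspace X) (\<lambda>j. \<Union>n\<in>{k j..<k (Suc j)}. U n)"
    unfolding gamma_cover_def
  proof
    fix x assume x: "x \<in> mspace X"
    then obtain m where m: "f x \<in> C m" using K C by blast
    have ge: "x \<in> (\<Union>n\<in>{k j..<k (Suc j)}. U n)" if "j \<ge> m" for j
    proof -
      have "f x \<in> D j" using m that by (auto simp: D_def)
      then obtain i where i: "i < N j (k j)" "f x \<in> G j (k j) i" using G[of j "k j"] by blast
      then have "x \<in> U (k j + i)" using x by (auto simp: U_def kSuc intro!: exI[of _ j])
      moreover have "k j + i \<in> {k j..<k (Suc j)}" using i by (simp add: kSuc)
      ultimately show ?thesis by blast
    qed
    show "finite {j. x \<notin> (\<Union>n\<in>{k j..<k (Suc j)}. U n)}"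
    proof (rule finite_subset)
      show "{j. x \<notin> (\<Union>n\<in>{k j..<k (Suc j)}. U n)} \<subseteq> {..<m}"
        using ge by (fastforce simp: not_le[symmetric])
    qed simp
  qed
  then have "gamma_groupable_cover (mspace X) U"
    unfolding gamma_groupable_cover_def using k0 k by blast
  moreover have "U n \<subseteq> mspace X \<and> mdiam X (U n) \<le> ennreal (\<epsilon> n)" for n
    using Ud[of _ n] \<epsilon>[of n] by (auto simp: U_def mdiam_le_iff)
  ultimately show ?thesis by blast
qed

theorem theorem3p11:
  fixes X :: "'a metric"
  assumes separable: "separable_space (mtopology_of X)"
    and universe: "(UNIV :: real set) \<lesssim> (UNIV :: 'b set)"
  shows "sharp_measure_zero TYPE('b) X \<longleftrightarrow>
    (\<forall>\<epsilon> :: nat \<Rightarrow> real. (\<forall>n. \<epsilon> n > 0) \<longrightarrow>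
      (\<exists>U :: nat \<Rightarrow> 'a set.
        (\<forall>n. U n \<subseteq> mspace X \<and> mdiam X (U n) \<le> ennreal (\<epsilon> n)) \<and>
        gamma_groupable_cover (mspace X) U))"
proof
  assume "sharp_measure_zero TYPE('b) X"
  then show "\<forall>\<epsilon> :: nat \<Rightarrow> real. (\<forall>n. \<epsilon> n > 0) \<longrightarrow>
      (\<exists>U :: nat \<Rightarrow> 'a set. (\<forall>n. U n \<subseteq> mspace X \<and> mdiam X (U n) \<le> ennreal (\<epsilon> n)) \<and>
        gamma_groupable_cover (mspace X) U)"
    using gamma_groupable_covers_if_sharp_measure_zero[OF separable universe] by simp
qed (rule sharp_measure_zero_if_gamma_groupable_covers, simp)

end
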